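(* Let $F:\Omega\subseteq\mathbb{R}^m\to\mathbb{R}^m$ be $k$-times Fréchet differentiable in a convex set $\Omega$ containing the root $\alpha$ of $F(x)=0$. Then the Midpoint-Trapezoidal Newton's method $$x_{n+1}=x_n-4\Big[F'(x_n)+2F'\Big(\frac{x_n+y_n}{2}\Big)+F'(y_n)\Big]^{-1}F(x_n),\qquad n=0,1,\dots,$$ where $$y_n=x_n-F'(x_n)^{-1}F(x_n),$$ has third-order convergence.
   Context: $F'(x)$ denotes the Jacobian matrix (Fréchet derivative) of $F$ at $x$, and $F'(x)^{-1}$ its inverse. The number $k$ is a positive integer for which no specific value is given in the statement; $F$ is assumed throughout to be sufficiently differentiable. The iteration generates $x_1,x_2,\dots$ from a starting point $x_0$ as approximations to $\alpha$, and "third-order convergence" refers to the order of convergence of $x_n$ to $\alpha$ in the usual sense.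
   Formalization: Added: F'(α) is invertible (for F(x)=x² the method converges only linearly), k ≥ 3 (for F(x)=x+|x|^{5/2}sgn x, with k=2, the order is 5/2), and α is an interior point of Ω (otherwise iterates may leave Ω); third order means order at least three, locally near α. *)

theory Defs
  imports "HOL-Analysis.Analysis"
begin

text \<open>
  The derivative of order \<open>j + 1\<close> is reached by differentiating, for every fixed direction \<open>v\<close>, the
  map sending \<open>x\<close> to \<open>f'(x) v\<close>; this avoids the growing types of nested operator spaces. On a
  finite-dimensional domain it is the usual notion, since an operator-valued map is then Frechet
  differentiable iff its evaluation at each vector is. No continuity of the derivative of
  order \<open>k\<close> is required. Derivatives are taken within \<open>S\<close>; they are unique if \<open>S\<close> is open or convex
  with nonempty interior, and at interior points they are the ordinary Frechet derivatives.
\<close>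

primrec times_frechet_differentiable_on ::
    "nat \<Rightarrow> ('a::euclidean_space \<Rightarrow> 'b::euclidean_space) \<Rightarrow> 'a set \<Rightarrow> bool" where
  "times_frechet_differentiable_on 0 f S \<longleftrightarrow> True"
| "times_frechet_differentiable_on (Suc k) f S \<longleftrightarrow>
     f differentiable_on S \<and>
     (\<forall>v. times_frechet_differentiable_on k (\<lambda>x. frechet_derivative f (at x within S) v) S)"

definition newton_point :: "(real ^ 'm \<Rightarrow> real ^ 'm) \<Rightarrow> real ^ 'm \<Rightarrow> real ^ 'm" where
  "newton_point F x = x - matrix_inv (jacobian F (at x)) *v F x"

definition mtn_matrix :: "(real ^ 'm \<Rightarrow> real ^ 'm) \<Rightarrow> real ^ 'm \<Rightarrow> real ^ 'm ^ 'm" where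
  "mtn_matrix F x =
     (let y = newton_point F x
      in jacobian F (at x) + 2 *\<^sub>R jacobian F (at (midpoint x y)) + jacobian F (at y))"

definition mtn_step :: "(real ^ 'm \<Rightarrow> real ^ 'm) \<Rightarrow> real ^ 'm \<Rightarrow> real ^ 'm" where
  "mtn_step F x = x - 4 *\<^sub>R (matrix_inv (mtn_matrix F x) *v F x)"

text \<open>
  Order of convergence is meant as Q-order at least \<open>p\<close> with constant \<open>C\<close>, for \<open>p > 1\<close>. The
  constant is not required to be optimal or nonzero, as particular \<open>F\<close> (affine ones, for instance)
  converge faster.
\<close>

definition converges_with_order ::
    "nat \<Rightarrow> real \<Rightarrow> (nat \<Rightarrow> 'a::real_normed_vector) \<Rightarrow> 'a \<Rightarrow> bool" where
  "converges_with_order p C x a \<longleftrightarrow>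
     x \<longlonglongrightarrow> a \<and> (\<forall>n. norm (x (Suc n) - a) \<le> C * norm (x n - a) ^ p)"

text \<open>
  \<^const>\<open>matrix_inv\<close> is unspecified on singular matrices and \<^const>\<open>jacobian\<close> where the derivative
  does not exist, so the recursion alone does not say that the iteration is well defined. The
  midpoint needs no separate clause when the domain is convex.
\<close>

definition mtn_well_defined ::
    "(real ^ 'm \<Rightarrow> real ^ 'm) \<Rightarrow> (real ^ 'm) set \<Rightarrow> real ^ 'm \<Rightarrow> bool" where
  "mtn_well_defined F S x \<longleftrightarrow>
     x \<in> interior S \<and> invertible (jacobian F (at x)) \<and>
     newton_point F x \<in> interior S \<and> invertible (mtn_matrix F x)"

end

theory Submission
  imports Defs
begin

text \<open>
  Write \<open>e = x - \<alpha>\<close>, \<open>A = F'(\<alpha>)\<close> and \<open>B(h) = F''(\<alpha>)(h, \<cdot>)\<close>. The existence of the third derivative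
  at \<open>\<alpha>\<close> makes \<open>F''\<close> satisfy a Lipschitz bound centred at \<open>\<alpha>\<close>, so the mean value inequality gives
  \<open>F'(x) = A + B(e) + O(\<bar>e\<bar>\<^sup>2)\<close> and then \<open>F(x) = A e + B(e) e / 2 + O(\<bar>e\<bar>\<^sup>3)\<close>, without any continuity of
  the third derivative. The Newton point \<open>y\<close> has error \<open>O(\<bar>e\<bar>\<^sup>2)\<close>, hence the averaged matrix is
  \<open>M = 4 A + 2 B(e) + O(\<bar>e\<bar>\<^sup>2)\<close>. In \<open>M e - 4 F(x)\<close> the terms of first and second order cancel, and
  multiplying by the locally bounded \<open>M\<^sup>-\<^sup>1\<close> leaves an error \<open>O(\<bar>e\<bar>\<^sup>3)\<close>.
\<close>

section \<open>Matrix norms and inverses of nearby matrices\<close>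

lemma norm_matrix_vector_mult_le:
  fixes A :: "real ^ 'n ^ 'm"
  shows "norm (A *v x) \<le> norm A * norm x"
proof -
  have "norm (A *v x) \<le> L2_set (\<lambda>i. norm (A $ i) * norm x) UNIV"
    unfolding norm_vec_def[of "A *v x"]
    by (intro L2_set_mono) (simp_all add: matrix_mult_dot Cauchy_Schwarz_ineq2)
  also have "\<dots> = norm A * norm x"
    by (simp add: norm_vec_def[of A] L2_set_left_distrib)
  finally show ?thesis .
qed

lemma norm_axis:
  fixes c :: "'a::real_inner"
  shows "norm (axis j c) = norm c"
  by (simp add: norm_eq_sqrt_inner inner_axis_axis)

text \<open>The matrix splits into its single-column parts, and the norm of such a part is the
  Euclidean norm of the column. Estimates for Jacobians thereby reduce to estimates for directional
  derivatives.\<close>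

lemma norm_matrix_le_sum_axis:
  fixes A :: "real ^ 'n ^ 'm"
  shows "norm A \<le> (\<Sum>j\<in>UNIV. norm (A *v axis j 1))"
proof -
  define E :: "'n \<Rightarrow> real ^ 'n ^ 'm" where "E j = (\<chi> i. axis j (A $ i $ j))" for j
  have "A = (\<Sum>j\<in>UNIV. E j)"
    by (simp add: vec_eq_iff axis_def E_def)
  then have "norm A \<le> (\<Sum>j\<in>UNIV. norm (E j))"
    by (metis norm_sum)
  also have "\<dots> = (\<Sum>j\<in>UNIV. norm (A *v axis j 1))"
  proof (rule sum.cong)
    fix j
    show "norm (E j) = norm (A *v axis j 1)"
    unfolding norm_vec_def[of "E j"] norm_vec_def[of "A *v axis j 1"]
    by (simp add: E_def matrix_vector_mult_basis column_def norm_axis)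
  qed simp
  finally show ?thesis .
qed

lemma matrix_inv_vector_mult_cancel:
  fixes A :: "real ^ 'n ^ 'n"
  assumes "invertible A"
  shows "A *v (matrix_inv A *v v) = v" and "matrix_inv A *v (A *v v) = v"
  using someI_ex[OF assms[unfolded invertible_def]]
  by (simp_all add: matrix_inv_def matrix_vector_mul_assoc)

text \<open>An injective linear map in finite dimension is bounded below by some
  \<open>b > 0\<close>. A perturbation of norm less than \<open>b / 2\<close> keeps the lower bound
  \<open>b / 2\<close>, hence injectivity, and for a square matrix invertibility. Applied to
  \<open>matrix_inv M *v v\<close>, the lower bound becomes the uniform bound \<open>2 / b\<close>
  on the inverses.\<close>

lemma invertible_perturbation:
  fixes A :: "real ^ 'n ^ 'n"
  assumes "invertible A"
  obtains c where "c > 0"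
    "\<forall>\<^sub>F M in nhds A. invertible M \<and> (\<forall>v. norm (matrix_inv M *v v) \<le> c * norm v)"
proof -
  obtain b where b: "b > 0" "\<And>v. b * norm v \<le> norm (A *v v)"
    using linear_inj_bounded_below_pos[of "(*v) A"] inj_matrix_vector_mult[OF assms] by auto
  have "\<forall>\<^sub>F M in nhds A. dist M A < b / 2"
    using b(1) unfolding eventually_nhds_metric by (metis half_gt_zero)
  then have "\<forall>\<^sub>F M in nhds A. invertible M \<and> (\<forall>v. norm (matrix_inv M *v v) \<le> 2 / b * norm v)"
  proof eventually_elim
    case (elim M)
    have lower: "b / 2 * norm v \<le> norm (M *v v)" for v
    proof -
      have "norm ((A - M) *v v) \<le> b / 2 * norm v"
        using norm_matrix_vector_mult_le[of "A - M" v] elim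
        by (smt (verit) dist_norm mult_right_mono norm_ge_zero norm_minus_commute)
      moreover have "norm (A *v v) \<le> norm ((A - M) *v v) + norm (M *v v)"
        using norm_triangle_ineq[of "(A - M) *v v" "M *v v"]
        by (simp add: matrix_vector_mult_diff_rdistrib)
      ultimately show ?thesis using b(2)[of v] by argo
    qed
    have "inj ((*v) M)"
    proof (rule linear_injective_0[THEN iffD2])
      show "\<forall>v. M *v v = 0 \<longrightarrow> v = 0"
        using lower b(1) by (metis half_gt_zero mult_le_0_iff norm_le_zero_iff norm_zero not_le)
    qed simp
    then have inv: "invertible M"
      by (simp add: invertible_left_inverse matrix_left_invertible_injective)
    have "norm (matrix_inv M *v v) \<le> 2 / b * norm v" for v
      using lower[of "matrix_inv M *v v"] b(1)
      by (simp add: matrix_inv_vector_mult_cancel[OF inv] field_simps)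
    with inv show ?case by blast
  qed
  with b(1) that[of "2 / b"] show ?thesis by simp
qed

section \<open>Taylor remainders from differentiability at a single point\<close>

lemma differentiable_at_imp_linear_bound:
  fixes f :: "'a::real_normed_vector \<Rightarrow> 'b::real_normed_vector"
  assumes "f differentiable at a"
  obtains K where "K \<ge> 0" "\<forall>\<^sub>F x in nhds a. norm (f x - f a) \<le> K * norm (x - a)"
proof -
  obtain D where D: "(f has_derivative D) (at a)"
    using assms by (auto simp: differentiable_def)
  interpret bounded_linear D using D by (rule has_derivative_bounded_linear)
  obtain L where L: "L \<ge> 0" "\<And>h. norm (D h) \<le> norm h * L" using nonneg_bounded by blast
  \<comment> \<open>The definition of the derivative is used with epsilon equal to 1, whence the
    constant \<open>L + 1\<close>.\<close>
  obtain d where d: "d > 0"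
    "\<And>x. norm (x - a) < d \<Longrightarrow> norm (f x - f a - D (x - a)) \<le> 1 * norm (x - a)"
    using has_derivative_within_alt[THEN iffD1, OF D] by (metis UNIV_I zero_less_one)
  have "norm (f x - f a) \<le> (L + 1) * norm (x - a)" if "norm (x - a) < d" for x
    using d(2)[OF that] L(2)[of "x - a"] norm_triangle_sub[of "f x - f a" "D (x - a)"]
    by (simp add: algebra_simps)
  with d(1) have "\<forall>\<^sub>F x in nhds a. norm (f x - f a) \<le> (L + 1) * norm (x - a)"
    by (auto simp: eventually_nhds_metric dist_norm)
  with L(1) that[of "L + 1"] show ?thesis by simp
qed

text \<open>Differentiability of \<open>g'\<close> at the one point \<open>a\<close> gives a linear
  bound for each of the finitely many basis directions, and these add up to an operator norm bound.
  The mean value inequality on the ball of radius \<open>norm (x - a)\<close>, with the derivative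
  at \<open>a\<close> subtracted, contributes the second factor.\<close>

lemma quadratic_remainder_bound:
  fixes g :: "'a::euclidean_space \<Rightarrow> 'b::real_normed_vector"
  assumes deriv: "\<forall>\<^sub>F x in nhds a. (g has_derivative g' x) (at x)"
    and diff: "\<And>w. (\<lambda>x. g' x w) differentiable at a"
  obtains K where "\<forall>\<^sub>F x in nhds a. norm (g x - g a - g' a (x - a)) \<le> K * norm (x - a) ^ 2"
proof -
  have "\<forall>w. \<exists>K\<ge>0. \<forall>\<^sub>F x in nhds a. norm (g' x w - g' a w) \<le> K * norm (x - a)"
    by (intro allI) (rule differentiable_at_imp_linear_bound[OF diff], blast)
  then obtain L where L: "\<And>w. L w \<ge> 0"
    "\<And>w. \<forall>\<^sub>F x in nhds a. norm (g' x w - g' a w) \<le> L w * norm (x - a)"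
    using choice[of "\<lambda>w K. K \<ge> 0 \<and> (\<forall>\<^sub>F x in nhds a. norm (g' x w - g' a w) \<le> K * norm (x - a))"]
    by blast
  define K where "K = (\<Sum>w\<in>Basis. L w)"
  have "\<forall>\<^sub>F x in nhds a. \<forall>w\<in>Basis. norm (g' x w - g' a w) \<le> L w * norm (x - a)"
    using L(2) by (intro eventually_ball_finite) auto
  with deriv have "\<forall>\<^sub>F x in nhds a. (g has_derivative g' x) (at x) \<and>
      (\<forall>w\<in>Basis. norm (g' x w - g' a w) \<le> L w * norm (x - a))"
    by (rule eventually_conj)
  then obtain d where d: "d > 0" and der: "\<And>x. dist x a < d \<Longrightarrow> (g has_derivative g' x) (at x)"
    and lip: "\<And>x w. dist x a < d \<Longrightarrow> w \<in> Basis \<Longrightarrow> norm (g' x w - g' a w) \<le> L w * norm (x - a)"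
    unfolding eventually_nhds_metric by blast
  have on: "onorm (g' x - g' a) \<le> K * norm (x - a)" if "dist x a < d" for x
  proof -
    have "bounded_linear (\<lambda>h. g' x h - g' a h)"
      using der[OF that] der[of a] d
      by (intro bounded_linear_sub has_derivative_bounded_linear[where f = g]) auto
    then have "onorm (g' x - g' a) \<le> (\<Sum>w\<in>Basis. norm (g' x w - g' a w))"
      using onorm_componentwise[of "g' x - g' a"] by (simp add: fun_diff_def)
    also have "\<dots> \<le> (\<Sum>w\<in>Basis. L w * norm (x - a))"
      by (intro sum_mono lip that)
    finally show ?thesis by (simp add: K_def sum_distrib_right)
  qed
  have "norm (g x - g a - g' a (x - a)) \<le> K * norm (x - a) ^ 2" if x: "dist x a < d" for x
  proof -
    let ?S = "cball a (norm (x - a))"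
    have S: "dist z a < d \<and> norm (z - a) \<le> norm (x - a)" if "z \<in> ?S" for z
      using that x by (simp add: dist_norm norm_minus_commute)
    have "norm (g x - g a - g' a (x - a)) \<le> norm (x - a) * (K * norm (x - a))"
    proof (rule differentiable_bound_linearization[where S = ?S])
      fix z assume z: "z \<in> ?S"
      show "(g has_derivative g' z) (at z within ?S)"
        using der S[OF z] has_derivative_at_withinI by blast
      have "K \<ge> 0" unfolding K_def by (intro sum_nonneg L)
      then show "onorm (g' z - g' a) \<le> K * norm (x - a)"
        using on[of z] S[OF z] by (meson mult_left_mono order_trans)
    next
      fix t :: real assume "t \<in> {0..1}"
      then show "a + t *\<^sub>R (x - a) \<in> ?S"
        by (auto simp: dist_norm intro: mult_left_le_one_le)
    qed simp
    then show ?thesis by (simp add: power2_eq_square ac_simps)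
  qed
  with d that show ?thesis unfolding eventually_nhds_metric by blast
qed

text \<open>Along the segment from \<open>a\<close> to \<open>x\<close>, the derivative of
  \<open>F\<close> minus its quadratic Taylor polynomial is the remainder of \<open>J\<close>
  applied to \<open>x - a\<close>. The mean value theorem then raises the order by one; it loses the
  factor 1/3 that integration would give, but asks for no integrability of \<open>J\<close>.\<close>

lemma cubic_remainder_bound:
  fixes F :: "real ^ 'n \<Rightarrow> real ^ 'm"
  assumes deriv: "\<forall>\<^sub>F x in nhds a. (F has_derivative (\<lambda>h. J x *v h)) (at x)"
    and B: "linear B"
    and J: "\<forall>\<^sub>F x in nhds a. norm (J x - J a - B (x - a)) \<le> K * norm (x - a) ^ 2"
  shows "\<forall>\<^sub>F x in nhds a. norm (F x - F a - J a *v (x - a) - (1/2) *\<^sub>R (B (x - a) *v (x - a)))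
           \<le> \<bar>K\<bar> * norm (x - a) ^ 3"
proof -
  obtain d where d: "d > 0"
    and der: "\<And>x. dist x a < d \<Longrightarrow> (F has_derivative (\<lambda>h. J x *v h)) (at x)"
    and bd: "\<And>x. dist x a < d \<Longrightarrow> norm (J x - J a - B (x - a)) \<le> K * norm (x - a) ^ 2"
    using eventually_conj[OF deriv J] unfolding eventually_nhds_metric by blast
  have "norm (F x - F a - J a *v (x - a) - (1/2) *\<^sub>R (B (x - a) *v (x - a))) \<le> \<bar>K\<bar> * norm (x - a) ^ 3"
    if x: "dist x a < d" for x
  proof -
    define e where "e = x - a"
    \<comment> \<open>The difference \<open>p 1 - p 0\<close> is the remainder to be bounded, and
      \<open>p'\<close> is the derivative of \<open>p\<close>; the linearity of \<open>B\<close>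
      turns \<open>t\<close> times \<open>B e\<close> into \<open>B (t *\<^sub>R e)\<close>.\<close>
    define p where "p t = F (a + t *\<^sub>R e) - t *\<^sub>R (J a *v e) - (t\<^sup>2 / 2) *\<^sub>R (B e *v e)" for t
    define p' where "p' t = (J (a + t *\<^sub>R e) - J a - B (t *\<^sub>R e)) *v e" for t
    have near: "dist (a + t *\<^sub>R e) a < d" if "0 \<le> t" "t \<le> 1" for t
      using that x mult_left_le_one_le[of "norm e" t] by (simp add: dist_norm e_def)
    have p': "(p has_derivative (\<lambda>h. h *\<^sub>R p' t)) (at t)" if "0 \<le> t" "t \<le> 1" for t
    proof -
      have "((\<lambda>t. F (a + t *\<^sub>R e)) has_derivative (\<lambda>h. J (a + t *\<^sub>R e) *v (h *\<^sub>R e))) (at t)"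
        using der[OF near[OF that]]
        by (intro has_derivative_compose[of "\<lambda>t. a + t *\<^sub>R e" "\<lambda>h. h *\<^sub>R e" t UNIV F])
          (auto intro!: derivative_eq_intros)
      then show ?thesis
        unfolding p_def p'_def
        by (auto intro!: derivative_eq_intros
            simp: linear_scale[OF B] matrix_vector_mult_diff_rdistrib scaleR_matrix_vector_assoc[symmetric]
              matrix_vector_mult_scaleR algebra_simps)
    qed
    have "continuous_on {0..1} p"
      by (intro continuous_at_imp_continuous_on ballI has_derivative_continuous[OF p']) auto
    then obtain t where t: "0 < t" "t < 1" "norm (p 1 - p 0) \<le> norm (p' t)"
      using mvt_general[of 0 1 p "\<lambda>t h. h *\<^sub>R p' t"] p' by auto
    have "norm (p' t) \<le> (K * norm (t *\<^sub>R e) ^ 2) * norm e"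
      unfolding p'_def using bd[OF near[of t]] t(1,2)
      by (intro order_trans[OF norm_matrix_vector_mult_le] mult_right_mono) auto
    also have "\<dots> \<le> \<bar>K\<bar> * norm e ^ 3"
    proof -
      \<comment> \<open>The sign of \<open>K\<close> is unknown, so the factor
        \<open>t\<^sup>2\<close> can only be dropped after passing to the absolute value.\<close>
      have "t\<^sup>2 * K \<le> \<bar>K\<bar>"
        using t(1,2) by (smt (verit) abs_ge_self abs_ge_zero mult_left_le_one_le mult_left_mono power_le_one zero_le_power)
      then have "(t\<^sup>2 * K) * norm e ^ 3 \<le> \<bar>K\<bar> * norm e ^ 3"
        by (rule mult_right_mono) simp
      then show ?thesis
        by (simp add: power_mult_distrib power2_eq_square power3_eq_cube ac_simps)
    qed
    finally show ?thesis using t(3) by (simp add: p_def e_def algebra_simps)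
  qed
  with d show ?thesis unfolding eventually_nhds_metric by blast
qed


section \<open>Local error of one step\<close>

lemma eventually_nhds_norm_less:
  fixes a :: "'a::real_normed_vector"
  assumes "r > 0"
  shows "\<forall>\<^sub>F x in nhds a. norm (x - a) < r"
  unfolding eventually_nhds_metric dist_norm using assms by (intro exI[of _ r]) simp

text \<open>Limits are taken along \<open>nhds a\<close> and not \<open>at a\<close>: they then
  compose with bounds valid near \<open>a\<close> even where the inner map takes the value
  \<open>a\<close>, and an iterate may equal \<open>a\<close>.\<close>

lemma tendsto_nhds_linear_boundI:
  fixes f :: "'a::real_normed_vector \<Rightarrow> 'b::real_normed_vector"
  assumes "\<forall>\<^sub>F x in nhds a. norm (f x - l) \<le> K * norm (x - a)"
  shows "(f \<longlongrightarrow> l) (nhds a)"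
proof -
  have "((\<lambda>x. x) \<longlongrightarrow> a) (nhds a)" by (rule filterlim_ident)
  then have "((\<lambda>x. K * norm (x - a)) \<longlongrightarrow> K * norm (a - a)) (nhds a)"
    by (intro tendsto_intros)
  then have "((\<lambda>x. K * norm (x - a)) \<longlongrightarrow> 0) (nhds a)" by simp
  with assms have "((\<lambda>x. f x - l) \<longlongrightarrow> 0) (nhds a)" by (rule Lim_null_comparison)
  then show ?thesis by (rule LIM_zero_cancel)
qed

text \<open>The expansion of the Jacobian enters as a hypothesis, with \<open>B\<close> in the role
  of the second derivative at \<open>a\<close>. The first two conclusions serve to keep the
  iteration well defined, the third gives its order.\<close>

lemma mtn_step_cubic:
  fixes F :: "real ^ 'm \<Rightarrow> real ^ 'm"
  defines "J \<equiv> \<lambda>x. jacobian F (at x)"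
  assumes diff: "\<forall>\<^sub>F x in nhds a. F differentiable at x"
    and B: "linear B"
    and K: "\<forall>\<^sub>F x in nhds a. norm (J x - J a - B (x - a)) \<le> K * norm (x - a) ^ 2"
    and root: "F a = 0"
    and inv: "invertible (J a)"
  shows "(newton_point F \<longlongrightarrow> a) (nhds a)"
    and "\<forall>\<^sub>F x in nhds a. invertible (J x) \<and> invertible (mtn_matrix F x)"
    and "\<exists>C. \<forall>\<^sub>F x in nhds a. norm (mtn_step F x - a) \<le> C * norm (x - a) ^ 3"
proof -
  define y where "y = newton_point F"
  define M where "M = mtn_matrix F"
  have M: "M x = J x + 2 *\<^sub>R J (midpoint x (y x)) + J (y x)" for x
    by (simp add: M_def y_def mtn_matrix_def Let_def J_def)
  interpret B: linear B by (rule B)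
  obtain L where L: "L \<ge> 0" "\<And>h. norm (B h) \<le> L * norm h"
    using linear_bounded_pos[OF B] by (metis less_eq_real_def)
  define K' where "K' = \<bar>K\<bar>"
  have K'0: "K' \<ge> 0" by (simp add: K'_def)
  have J2: "\<forall>\<^sub>F x in nhds a. norm (J x - J a - B (x - a)) \<le> K' * norm (x - a) ^ 2"
    using K by eventually_elim
      (smt (verit) K'_def mult_right_mono zero_le_power norm_ge_zero)
  have F3: "\<forall>\<^sub>F x in nhds a. norm (F x - J a *v (x - a) - (1/2) *\<^sub>R (B (x - a) *v (x - a)))
              \<le> K' * norm (x - a) ^ 3"
    using cubic_remainder_bound[where F = F and J = J and a = a and B = B and K = K] diff B K
    by (simp add: jacobian_works root J_def K'_def)
  have small: "\<forall>\<^sub>F x in nhds a. norm (x - a) < 1"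
    by (rule eventually_nhds_norm_less) simp

  \<comment> \<open>For errors below 1 the square is absorbed into the first power. The resulting
    continuity of \<open>J\<close> at \<open>a\<close> is what carries the bound on inverses from
    \<open>J a\<close> over to \<open>J x\<close>.\<close>
  have "\<forall>\<^sub>F x in nhds a. norm (J x - J a) \<le> (L + K') * norm (x - a)"
    using J2 small
  proof eventually_elim
    case (elim x)
    have "K' * norm (x - a) ^ 2 \<le> K' * norm (x - a)"
      using elim(2) K'0 by (intro mult_left_mono) (simp_all add: power2_eq_square mult_left_le)
    then show ?case
      using elim(1) L(2)[of "x - a"] norm_triangle_sub[of "J x - J a" "B (x - a)"]
      by (simp add: algebra_simps)
  qed
  then have J_lim: "(J \<longlongrightarrow> J a) (nhds a)"
    by (rule tendsto_nhds_linear_boundI)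
  obtain c where c: "c > 0"
    "\<forall>\<^sub>F N in nhds (J a). invertible N \<and> (\<forall>v. norm (matrix_inv N *v v) \<le> c * norm v)"
    using invertible_perturbation[OF inv] .
  have J_inv: "\<forall>\<^sub>F x in nhds a. invertible (J x) \<and> (\<forall>v. norm (matrix_inv (J x) *v v) \<le> c * norm v)"
    by (rule eventually_compose_filterlim[OF c(2) J_lim])

  \<comment> \<open>The Newton error is the inverse of \<open>J x\<close> applied to
    \<open>R *v e - S + (1/2) *\<^sub>R (B e *v e)\<close>. The terms \<open>R *v e\<close> and
    \<open>S\<close> contribute \<open>K'\<close> each, after one factor \<open>norm e < 1\<close>
    is dropped; \<open>L\<close> covers the last term.\<close>
  define P where "P = c * (2 * K' + L)"
  have P0: "P \<ge> 0" using c L K'0 by (simp add: P_def)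
  have y2: "\<forall>\<^sub>F x in nhds a. norm (y x - a) \<le> P * norm (x - a) ^ 2"
    using J2 F3 small J_inv
  proof eventually_elim
    case (elim x)
    define e where "e = x - a"
    define R where "R = J x - J a - B e"
    define S where "S = F x - J a *v e - (1/2) *\<^sub>R (B e *v e)"
    have "norm e < 1" using elim(3) by (simp add: e_def)
    have "y x - a = matrix_inv (J x) *v (J x *v e - F x)"
      using elim(4) matrix_inv_vector_mult_cancel(2)[of "J x" e]
      by (simp add: y_def newton_point_def J_def e_def matrix_vector_mult_diff_distrib)
    also have "J x *v e - F x = R *v e - S + (1/2) *\<^sub>R (B e *v e)"
      by (simp add: R_def S_def matrix_vector_mult_diff_rdistrib algebra_simps flip: scaleR_2)
    finally have "norm (y x - a) \<le> c * norm (R *v e - S + (1/2) *\<^sub>R (B e *v e))"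
      using elim(4) by metis
    also have "norm (R *v e - S + (1/2) *\<^sub>R (B e *v e)) \<le> norm (R *v e) + norm S + norm (B e *v e) / 2"
      using norm_triangle_ineq[of "R *v e - S" "(1/2) *\<^sub>R (B e *v e)"]
        norm_triangle_ineq4[of "R *v e" S] by simp
    also have "\<dots> \<le> (2 * K' + L) * norm e ^ 2"
    proof -
      have R: "norm (R *v e) \<le> K' * norm e ^ 2 * norm e"
        using elim(1) by (intro order_trans[OF norm_matrix_vector_mult_le] mult_right_mono)
          (simp_all add: R_def e_def)
      have S: "norm S \<le> K' * norm e ^ 2 * norm e"
        using elim(2) by (simp add: S_def e_def power2_eq_square power3_eq_cube ac_simps)
      have "K' * norm e ^ 2 * norm e \<le> K' * norm e ^ 2"
        using \<open>norm e < 1\<close> K'0 by (intro mult_left_le) simp_all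
      moreover have "norm (B e *v e) \<le> L * norm e * norm e"
        using L(2) by (intro order_trans[OF norm_matrix_vector_mult_le] mult_right_mono) simp_all
      moreover have "L * norm e * norm e \<ge> 0" using L(1) by simp
      ultimately show ?thesis using R S by (simp add: power2_eq_square algebra_simps)
    qed
    finally show ?case using c(1) by (simp add: P_def e_def mult.assoc)
  qed
  \<comment> \<open>Within this radius \<open>P * norm (x - a) \<le> 1\<close>, so the Newton point
    is no farther from \<open>a\<close> than \<open>x\<close>. The summand 1 guards against
    \<open>P = 0\<close>.\<close>
  have "1 / (P + 1) > 0" using P0 by simp
  have y1: "\<forall>\<^sub>F x in nhds a. norm (y x - a) \<le> norm (x - a)"
    using y2 eventually_nhds_norm_less[OF \<open>1 / (P + 1) > 0\<close>, of a]
  proof eventually_elim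
    case (elim x)
    then have "P * norm (x - a) \<le> 1"
      using P0 by (simp add: field_simps) (smt (verit) norm_ge_zero)
    then have "P * norm (x - a) * norm (x - a) \<le> 1 * norm (x - a)"
      by (rule mult_right_mono) simp
    then show ?case using elim(1) by (simp add: power2_eq_square mult.assoc)
  qed
  then have y_lim: "(y \<longlongrightarrow> a) (nhds a)"
    by (intro tendsto_nhds_linear_boundI[where K = 1]) simp
  then show "(newton_point F \<longlongrightarrow> a) (nhds a)" by (simp add: y_def)
  have mid1: "\<forall>\<^sub>F x in nhds a. norm (midpoint x (y x) - a) \<le> norm (x - a)"
    using y1
  proof eventually_elim
    case (elim x)
    have "midpoint x (y x) - a = (1/2) *\<^sub>R ((x - a) + (y x - a))"
      by (simp add: midpoint_def algebra_simps flip: scaleR_2)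
    then have "norm (midpoint x (y x) - a) \<le> (norm (x - a) + norm (y x - a)) / 2"
      using norm_triangle_ineq[of "x - a" "y x - a"] by simp
    with elim show ?case by simp
  qed
  then have mid_lim: "((\<lambda>x. midpoint x (y x)) \<longlongrightarrow> a) (nhds a)"
    by (intro tendsto_nhds_linear_boundI[where K = 1]) simp
  note Jy = eventually_compose_filterlim[OF J2 y_lim]
    and Jmid = eventually_compose_filterlim[OF J2 mid_lim]

  \<comment> \<open>The Jacobian remainders at \<open>x\<close>, the midpoint and \<open>y x\<close>
    carry the weights 1, 2, 1. Since twice the midpoint error is the sum of the other two errors,
    the linear parts add up to \<open>2 *\<^sub>R B (x - a)\<close> plus
    \<open>2 *\<^sub>R B (y x - a)\<close>; the latter is of second order and gives
    \<open>2 * L * P\<close>.\<close>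
  define Q where "Q = 4 * K' + 2 * L * P"
  have M2: "\<forall>\<^sub>F x in nhds a. norm (M x - 4 *\<^sub>R J a - 2 *\<^sub>R B (x - a)) \<le> Q * norm (x - a) ^ 2"
    using J2 Jy Jmid y1 mid1 y2
  proof eventually_elim
    case (elim x)
    let ?m = "midpoint x (y x)"
    have B_mid: "2 *\<^sub>R B (?m - a) = B (x - a) + B (y x - a)"
    proof -
      have "2 *\<^sub>R (?m - a) = (x - a) + (y x - a)"
        by (simp add: midpoint_def algebra_simps flip: scaleR_2)
      then show ?thesis by (metis B.add B.scale)
    qed
    have "M x - 4 *\<^sub>R J a - 2 *\<^sub>R B (x - a) = (J x - J a - B (x - a))
        + 2 *\<^sub>R (J ?m - J a - B (?m - a)) + (J (y x) - J a - B (y x - a)) + 2 *\<^sub>R B (y x - a)"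
      by (simp add: M scaleR_diff_right B_mid) (simp add: vec_eq_iff)
    then have "norm (M x - 4 *\<^sub>R J a - 2 *\<^sub>R B (x - a)) \<le> norm (J x - J a - B (x - a))
        + 2 * norm (J ?m - J a - B (?m - a)) + norm (J (y x) - J a - B (y x - a)) + 2 * norm (B (y x - a))"
      by (simp only:) (intro norm_triangle_le add_mono, simp_all)
    moreover have "K' * norm (?m - a) ^ 2 \<le> K' * norm (x - a) ^ 2"
      "K' * norm (y x - a) ^ 2 \<le> K' * norm (x - a) ^ 2"
      using elim(4,5) K'0 by (auto intro!: mult_left_mono power_mono)
    moreover have "norm (B (y x - a)) \<le> L * (P * norm (x - a) ^ 2)"
      using L elim(6) by (meson mult_left_mono order_trans)
    ultimately show ?case using elim(1-3) by (simp add: Q_def algebra_simps)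
  qed
  have Q0: "Q \<ge> 0" using K'0 L P0 by (simp add: Q_def)
  have "\<forall>\<^sub>F x in nhds a. norm (M x - 4 *\<^sub>R J a) \<le> (2 * L + Q) * norm (x - a)"
    using M2 small
  proof eventually_elim
    case (elim x)
    have "Q * norm (x - a) ^ 2 \<le> Q * norm (x - a)"
      using elim(2) Q0 by (intro mult_left_mono) (simp_all add: power2_eq_square mult_left_le)
    then show ?case
      using elim(1) L(2)[of "x - a"] norm_triangle_sub[of "M x - 4 *\<^sub>R J a" "2 *\<^sub>R B (x - a)"]
      by (simp add: algebra_simps)
  qed
  then have M_lim: "(M \<longlongrightarrow> 4 *\<^sub>R J a) (nhds a)"
    by (rule tendsto_nhds_linear_boundI)
  have inv4: "invertible (4 *\<^sub>R J a)"
    using inv by (simp add: scalar_invertible)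
  obtain c' where c': "c' > 0"
    "\<forall>\<^sub>F N in nhds (4 *\<^sub>R J a). invertible N \<and> (\<forall>v. norm (matrix_inv N *v v) \<le> c' * norm v)"
    using invertible_perturbation[OF inv4] .
  have M_inv: "\<forall>\<^sub>F x in nhds a. invertible (M x) \<and> (\<forall>v. norm (matrix_inv (M x) *v v) \<le> c' * norm v)"
    by (rule eventually_compose_filterlim[OF c'(2) M_lim])
  show "\<forall>\<^sub>F x in nhds a. invertible (J x) \<and> invertible (mtn_matrix F x)"
    using J_inv M_inv by eventually_elim (simp add: M_def)

  have "\<forall>\<^sub>F x in nhds a. norm (mtn_step F x - a) \<le> (c' * (Q + 4 * K')) * norm (x - a) ^ 3"
    using F3 M2 M_inv
  proof eventually_elim
    case (elim x)
    define e where "e = x - a"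
    define R where "R = M x - 4 *\<^sub>R J a - 2 *\<^sub>R B e"
    define S where "S = F x - J a *v e - (1/2) *\<^sub>R (B e *v e)"
    have "mtn_step F x - a = matrix_inv (M x) *v (M x *v e - 4 *\<^sub>R F x)"
      using elim(3) matrix_inv_vector_mult_cancel(2)[of "M x" e]
      by (simp add: mtn_step_def M_def[symmetric] e_def matrix_vector_mult_diff_distrib
          matrix_vector_mult_scaleR)
    \<comment> \<open>The cancellation is exact: four times the term
      \<open>(1/2) *\<^sub>R (B e *v e)\<close> of \<open>F x\<close> meets the term
      \<open>2 *\<^sub>R B e\<close> of \<open>M x\<close>, so only the two remainders
      survive.\<close>
    also have "M x *v e - 4 *\<^sub>R F x = R *v e - 4 *\<^sub>R S"
      by (simp add: R_def S_def matrix_vector_mult_diff_rdistrib algebra_simps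
          flip: scaleR_matrix_vector_assoc)
    finally have "norm (mtn_step F x - a) \<le> c' * norm (R *v e - 4 *\<^sub>R S)"
      using elim(3) by metis
    also have "norm (R *v e - 4 *\<^sub>R S) \<le> norm (R *v e) + 4 * norm S"
      using norm_triangle_ineq4[of "R *v e" "4 *\<^sub>R S"] by simp
    also have "\<dots> \<le> (Q + 4 * K') * norm e ^ 3"
    proof -
      have "norm (R *v e) \<le> Q * norm e ^ 2 * norm e"
        using elim(2) by (intro order_trans[OF norm_matrix_vector_mult_le] mult_right_mono)
          (simp_all add: R_def e_def)
      moreover have "norm S \<le> K' * norm e ^ 3"
        using elim(1) by (simp add: S_def e_def)
      ultimately show ?thesis by (simp add: power2_eq_square power3_eq_cube algebra_simps)
    qed
    finally show ?case using c'(1) by (simp add: e_def mult.assoc)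
  qed
  then show "\<exists>C. \<forall>\<^sub>F x in nhds a. norm (mtn_step F x - a) \<le> C * norm (x - a) ^ 3"
    by blast
qed

section \<open>Expansion of the Jacobian from iterated directional derivatives\<close>

lemma jacobian_axis:
  fixes F :: "real ^ 'n \<Rightarrow> real ^ 'm"
  assumes "F differentiable at x"
  shows "jacobian F (at x) *v axis j 1 = frechet_derivative F (at x) (axis j 1)"
  using fun_cong[OF frechet_derivative_at[OF jacobian_works[THEN iffD1, OF assms]]] .

text \<open>The columns of the Jacobian are the derivatives of \<open>F\<close> along the coordinate
  axes, and \<open>quadratic_remainder_bound\<close> applies to each of them.\<close>

lemma jacobian_quadratic_remainder:
  fixes F :: "real ^ 'n \<Rightarrow> real ^ 'm"
  assumes F: "times_frechet_differentiable_on (Suc (Suc (Suc k))) F S" and a: "a \<in> interior S"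
  obtains B K where "linear B"
    "\<forall>\<^sub>F x in nhds a. norm (jacobian F (at x) - jacobian F (at a) - B (x - a)) \<le> K * norm (x - a) ^ 2"
proof -
  define G where "G j x = frechet_derivative F (at x within S) (axis j 1)" for j x
  define G' where "G' j x = frechet_derivative (G j) (at x within S)" for j x
  \<comment> \<open>One order of differentiability is spent on \<open>F\<close>, one on its columns
    \<open>G j\<close>, and the third on the derivatives \<open>G' j\<close> evaluated at a fixed
    vector.\<close>
  have F1: "F differentiable_on S" and G1: "G j differentiable_on S"
    and G2: "(\<lambda>x. G' j x w) differentiable_on S" for j w
    using F by (simp_all add: G_def[abs_def] G'_def[abs_def])
  have at_S: "at x within S = at x" "x \<in> S" if "x \<in> interior S" for x
    using that at_within_interior interior_subset by blast+
  have int: "\<forall>\<^sub>F x in nhds a. x \<in> interior S"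
    using a by (simp add: eventually_nhds_in_open)
  have G': "(G j has_derivative G' j x) (at x)" if "x \<in> interior S" for j x
    using G1 at_S[OF that] unfolding differentiable_on_def G'_def
    by (metis frechet_derivative_works)
  have "\<exists>K. \<forall>\<^sub>F x in nhds a. norm (G j x - G j a - G' j a (x - a)) \<le> K * norm (x - a) ^ 2" for j
  proof (rule quadratic_remainder_bound)
    show "\<forall>\<^sub>F x in nhds a. (G j has_derivative G' j x) (at x)"
      using int by eventually_elim (rule G')
    show "(\<lambda>x. G' j x w) differentiable at a" for w
      using G2 at_S[OF a] unfolding differentiable_on_def by metis
  qed blast
  then obtain K where K:
    "\<And>j. \<forall>\<^sub>F x in nhds a. norm (G j x - G j a - G' j a (x - a)) \<le> K j * norm (x - a) ^ 2"
    using choice[of "\<lambda>j K. \<forall>\<^sub>F x in nhds a. norm (G j x - G j a - G' j a (x - a)) \<le> K * norm (x - a) ^ 2"]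
    by blast
  \<comment> \<open>The second derivative at \<open>a\<close> as a matrix-valued linear map:
    \<open>h\<close> is the direction in which the Jacobian is differentiated, and column
    \<open>j\<close> comes from column \<open>j\<close> of the Jacobian.\<close>
  define B :: "real ^ 'n \<Rightarrow> real ^ 'n ^ 'm" where "B h = (\<chi> i j. G' j a h $ i)" for h
  have lin: "linear (G' j a)" for j
    using G'[OF a] by (rule has_derivative_linear)
  have B_axis: "B h *v axis j 1 = G' j a h" for h j
    by (simp add: B_def matrix_vector_mult_basis column_def)
  have J_axis: "jacobian F (at x) *v axis j 1 = G j x" if "x \<in> interior S" for x j
    using F1 at_S[OF that] unfolding differentiable_on_def G_def by (metis jacobian_axis)
  have "\<forall>\<^sub>F x in nhds a. \<forall>j\<in>UNIV. norm (G j x - G j a - G' j a (x - a)) \<le> K j * norm (x - a) ^ 2"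
    using K by (intro eventually_ball_finite) auto
  with int have "\<forall>\<^sub>F x in nhds a.
      norm (jacobian F (at x) - jacobian F (at a) - B (x - a)) \<le> (\<Sum>j\<in>UNIV. K j) * norm (x - a) ^ 2"
  proof eventually_elim
    case (elim x)
    have "norm (jacobian F (at x) - jacobian F (at a) - B (x - a))
        \<le> (\<Sum>j\<in>UNIV. norm (G j x - G j a - G' j a (x - a)))"
      using norm_matrix_le_sum_axis[of "jacobian F (at x) - jacobian F (at a) - B (x - a)"] elim(1) a
      by (simp add: matrix_vector_mult_diff_rdistrib J_axis B_axis)
    also have "\<dots> \<le> (\<Sum>j\<in>UNIV. K j * norm (x - a) ^ 2)"
      using elim(2) by (intro sum_mono) auto
    finally show ?case by (simp add: sum_distrib_right)
  qed
  moreover have "linear B"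
    by (rule linearI) (simp_all add: B_def vec_eq_iff linear_add[OF lin] linear_scale[OF lin])
  ultimately show ?thesis using that by blast
qed

section \<open>From the local error bound to convergence of the iteration\<close>

lemma local_iteration_converges_with_order:
  fixes T :: "'a::real_normed_vector \<Rightarrow> 'a"
  assumes T: "\<forall>\<^sub>F x in nhds a. P x \<and> norm (T x - a) \<le> C * norm (x - a) ^ p" and p: "2 \<le> p"
  obtains \<delta> where "\<delta> > 0"
    "\<And>x. \<lbrakk>x 0 \<in> ball a \<delta>; \<And>n. x (Suc n) = T (x n)\<rbrakk> \<Longrightarrow> (\<forall>n. P (x n)) \<and> converges_with_order p C x a"
proof -
  obtain r where r: "r > 0" "\<And>x. dist x a < r \<Longrightarrow> P x"
    "\<And>x. dist x a < r \<Longrightarrow> norm (T x - a) \<le> C * norm (x - a) ^ p"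
    using T unfolding eventually_nhds_metric by blast
  \<comment> \<open>The bound \<open>r\<close> secures \<open>P\<close> and the error estimate, the
    bound 1 allows the exponent \<open>p\<close> to be lowered to 2, and the last one makes the step
    a contraction with factor 1/2. Adding 1 to \<open>\<bar>C\<bar>\<close> matters for
    \<open>C = 0\<close>, where the quotient would otherwise be 0.\<close>
  define \<delta> where "\<delta> = min (min r 1) (1 / (2 * (\<bar>C\<bar> + 1)))"
  have \<delta>: "\<delta> > 0" "\<delta> \<le> r" "\<delta> \<le> 1" "\<bar>C\<bar> * \<delta> \<le> 1 / 2"
  proof -
    show "\<delta> > 0" "\<delta> \<le> r" "\<delta> \<le> 1" using r(1) unfolding \<delta>_def by (simp, linarith, linarith)
    have "\<delta> \<le> 1 / (2 * (\<bar>C\<bar> + 1))" by (simp add: \<delta>_def)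
    then have "(\<bar>C\<bar> + 1) * \<delta> \<le> 1 / 2" by (simp add: field_simps)
    with \<open>\<delta> > 0\<close> show "\<bar>C\<bar> * \<delta> \<le> 1 / 2" by (simp add: algebra_simps)
  qed
  have half: "norm (T z - a) \<le> norm (z - a) / 2" if z: "norm (z - a) < \<delta>" for z
  proof -
    let ?e = "norm (z - a)"
    have "norm (T z - a) \<le> C * ?e ^ p" using r(3)[of z] z \<delta> by (simp add: dist_norm)
    also have "\<dots> \<le> \<bar>C\<bar> * ?e ^ p" by (simp add: mult_right_mono)
    also have "\<dots> \<le> \<bar>C\<bar> * ?e ^ 2"
      using z \<delta> p by (intro mult_left_mono power_decreasing) auto
    also have "\<dots> = (\<bar>C\<bar> * ?e) * ?e" by (simp add: power2_eq_square)
    also have "\<dots> \<le> (\<bar>C\<bar> * \<delta>) * ?e" using z by (intro mult_right_mono mult_left_mono) auto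
    also have "\<dots> \<le> 1 / 2 * ?e" using \<delta> by (intro mult_right_mono) auto
    finally show ?thesis by simp
  qed
  show thesis
  proof (rule that[OF \<delta>(1)])
    fix x assume x0: "x 0 \<in> ball a \<delta>" and step: "\<And>n. x (Suc n) = T (x n)"
    \<comment> \<open>The first conjunct keeps every iterate where \<open>half\<close> applies; the
      second yields the limit by comparison with a geometric sequence.\<close>
    have dec: "norm (x n - a) < \<delta> \<and> norm (x n - a) \<le> \<delta> * (1 / 2) ^ n" for n
    proof (induction n)
      case 0
      then show ?case using x0 by (simp add: dist_norm norm_minus_commute)
    next
      case (Suc n)
      have "norm (x (Suc n) - a) \<le> norm (x n - a) / 2" using half[of "x n"] Suc by (simp add: step)
      moreover have "norm (x n - a) / 2 \<le> norm (x n - a)"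
        "\<delta> * (1 / 2) ^ Suc n = \<delta> * (1 / 2) ^ n / 2" by simp_all
      ultimately show ?case using Suc by (intro conjI; linarith)
    qed
    have near: "dist (x n) a < r" for n
      using dec[of n] \<delta>(2) by (simp add: dist_norm)
    have "(\<lambda>n. \<delta> * (1 / 2) ^ n) \<longlonglongrightarrow> 0"
      by (intro tendsto_mult_right_zero LIMSEQ_power_zero) simp
    then have "(\<lambda>n. x n - a) \<longlonglongrightarrow> 0"
      by (rule Lim_null_comparison[OF always_eventually, rotated]) (simp add: dec)
    then have "x \<longlonglongrightarrow> a"
      by (rule LIM_zero_cancel)
    then show "(\<forall>n. P (x n)) \<and> converges_with_order p C x a"
      using r near step by (simp add: converges_with_order_def)
  qed
qed

text \<open>The order is a local notion: \<open>\<delta>\<close> and \<open>C\<close> are fixed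
  before the sequence, so one constant serves all starting points in the ball. Three derivatives, an
  interior root and an invertible Jacobian there make the implicit regularity explicit.\<close>

theorem theorem3p1:
  fixes F :: "real ^ 'm \<Rightarrow> real ^ 'm" and \<Omega> :: "(real ^ 'm) set"
    and \<alpha> :: "real ^ 'm" and k :: nat
  assumes "3 \<le> k"
    and "convex \<Omega>"
    and "times_frechet_differentiable_on k F \<Omega>"
    and "\<alpha> \<in> interior \<Omega>"
    and "F \<alpha> = 0"
    and "invertible (jacobian F (at \<alpha>))"
  shows "\<exists>\<delta>>0. \<exists>C. \<forall>x :: nat \<Rightarrow> real ^ 'm.
           x 0 \<in> ball \<alpha> \<delta> \<longrightarrow> (\<forall>n. x (Suc n) = mtn_step F (x n)) \<longrightarrow>
             (\<forall>n. mtn_well_defined F \<Omega> (x n)) \<and> converges_with_order 3 C x \<alpha>"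
proof -
  obtain l where l: "k = Suc (Suc (Suc l))"
    using le_Suc_ex[OF \<open>3 \<le> k\<close>] by (auto simp: numeral_3_eq_3)
  obtain B K where B: "linear B" and K:
    "\<forall>\<^sub>F x in nhds \<alpha>. norm (jacobian F (at x) - jacobian F (at \<alpha>) - B (x - \<alpha>)) \<le> K * norm (x - \<alpha>) ^ 2"
    by (rule jacobian_quadratic_remainder[OF assms(3)[unfolded l] assms(4)])
  have int: "\<forall>\<^sub>F x in nhds \<alpha>. x \<in> interior \<Omega>"
    using assms(4) by (simp add: eventually_nhds_in_open)
  have "F differentiable_on \<Omega>" using assms(3) by (simp add: l)
  then have "F differentiable at x" if "x \<in> interior \<Omega>" for x
    using that interior_subset[of \<Omega>] at_within_interior[OF that]
    by (metis differentiable_on_def subsetD)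
  with int have diff: "\<forall>\<^sub>F x in nhds \<alpha>. F differentiable at x"
    by (rule eventually_mono)
  note step = mtn_step_cubic[OF diff B K assms(5,6)]
  obtain C where C: "\<forall>\<^sub>F x in nhds \<alpha>. norm (mtn_step F x - \<alpha>) \<le> C * norm (x - \<alpha>) ^ 3"
    using step(3) by blast
  \<comment> \<open>The Newton point tends to \<open>\<alpha>\<close>, so it too is eventually in
    the interior; with the invertibility of both matrices this completes well-definedness near
    \<open>\<alpha>\<close>.\<close>
  have "\<forall>\<^sub>F x in nhds \<alpha>. mtn_well_defined F \<Omega> x \<and> norm (mtn_step F x - \<alpha>) \<le> C * norm (x - \<alpha>) ^ 3"
    using int eventually_compose_filterlim[OF int step(1)] step(2) C
    by eventually_elim (simp add: mtn_well_defined_def)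
  then obtain \<delta> where "\<delta> > 0" and \<delta>: "\<And>x. \<lbrakk>x 0 \<in> ball \<alpha> \<delta>; \<And>n. x (Suc n) = mtn_step F (x n)\<rbrakk>
      \<Longrightarrow> (\<forall>n. mtn_well_defined F \<Omega> (x n)) \<and> converges_with_order 3 C x \<alpha>"
    by (rule local_iteration_converges_with_order) simp_all
  show ?thesis
    by (intro exI[of _ \<delta>] exI[of _ C] conjI \<open>\<delta> > 0\<close> allI impI \<delta>) simp_all
qed

end
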